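(* Let $\alpha\in(0,\pi)$. Then $\dim\mathcal{V}_0^{\alpha}=1$ and $$\dim\mathcal{V}_{n}^{\alpha}=\dim\mathcal{V}_{n-1}^{\alpha}+6n\quad\text{for all integers } n\geq 1.$$ Thus $$\dim\mathcal{V}_{n}^{\alpha}=1+6\sum_{i=1}^{n}i=3n(n+1)+1=\delta_n,$$ and for $n\ge 1$ this is equal to $\dim\mathcal{T}_{2n}^{\alpha}$.
   Context: For $\alpha\in(0,\pi)$ let $\Omega^{\alpha}=\{(u,v,w)\in[0,\alpha]^3: u+v+w=\alpha\}$. All functions below are real-valued functions of $(u,v,w)\in\Omega^{\alpha}$, and spans and dimensions are over $\mathbb{R}$. Write $\delta_n=3n(n+1)+1$. For an integer $n\ge 0$, $$\mathcal{V}_n^{\alpha}=\operatorname{span}\left\{\cos(ru+gv+bw),\ \sin(ru+gv+bw)\ :\ r,g,b\in\{0,1,\ldots,n\}\right\}.$$ For an integer $n\ge 1$, $0\le j\le n$ and $j\le i\le 2n-j$, define $$R_{2n,2n-i,j}^{\alpha}(u,v,w)=\begin{cases}\sin^{2n-i}\frac{u}{2}\,\sin^{i}\frac{w}{2}\,\cos^{i-j}\frac{v}{2}\,\sin^{j}\frac{v}{2}, & j\le i\le n,\\[4pt] \sin^{2n-i}\frac{u}{2}\,\sin^{i}\frac{w}{2}\,\cos^{2n-i-j}\frac{v}{2}\,\sin^{j}\frac{v}{2}, & n+1\le i\le 2n-j,\end{cases}$$ and $$G_{2n,2n-i,j}^{\alpha}(u,v,w)=R_{2n,2n-i,j}^{\alpha}(w,u,v),\qquad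 B_{2n,2n-i,j}^{\alpha}(u,v,w)=R_{2n,2n-i,j}^{\alpha}(v,w,u).$$ Let $$T_{2n}^{\alpha}=\left\{R_{2n,2n-i,j}^{\alpha},\ G_{2n,2n-i,j}^{\alpha},\ B_{2n,2n-i,j}^{\alpha}\ :\ 0\le j\le n-1,\ j\le i\le 2n-1-j\right\}\cup\left\{R_{2n,n,n}^{\alpha}\right\},$$ and $\mathcal{T}_{2n}^{\alpha}=\operatorname{span}T_{2n}^{\alpha}$. *)

theory Defs
  imports "HOL-Analysis.Analysis" "HOL-Library.Function_Algebras"
begin

text \<open>
  Pointwise scalar multiplication completes the pointwise operations of
  \<^theory>\<open>HOL-Library.Function_Algebras\<close> to a real vector space, so that the library
  notions \<^const>\<open>span\<close> and \<^const>\<open>dim\<close> apply to sets of functions.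
\<close>

instantiation "fun" :: (type, real_vector) real_vector
begin

definition scaleR_fun_def: "scaleR c f = (\<lambda>x. scaleR c (f x))"

instance
  by standard (auto simp: fun_eq_iff scaleR_fun_def scaleR_add_right scaleR_add_left)

end

lemma scaleR_fun_apply [simp]: "(c *\<^sub>R f) x = c *\<^sub>R f x"
  by (simp add: scaleR_fun_def)

definition Omega :: "real \<Rightarrow> (real \<times> real \<times> real) set" where
  "Omega \<alpha> = {(u, v, w). u \<in> {0..\<alpha>} \<and> v \<in> {0..\<alpha>} \<and> w \<in> {0..\<alpha>} \<and> u + v + w = \<alpha>}"

text \<open>
  A real-valued function on \<^term>\<open>Omega \<alpha>\<close> is represented by its extension by zero to the
  whole space.  This identifies the real-valued functions on \<^term>\<open>Omega \<alpha>\<close> linearly with a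
  subspace of \<^typ>\<open>real \<times> real \<times> real \<Rightarrow> real\<close>; in particular, two functions are
  equal iff they agree on \<^term>\<open>Omega \<alpha>\<close>.
\<close>

definition on_Omega ::
  "real \<Rightarrow> (real \<times> real \<times> real \<Rightarrow> real) \<Rightarrow> real \<times> real \<times> real \<Rightarrow> real" where
  "on_Omega \<alpha> f = (\<lambda>p. if p \<in> Omega \<alpha> then f p else 0)"

definition V_space :: "real \<Rightarrow> nat \<Rightarrow> (real \<times> real \<times> real \<Rightarrow> real) set" where
  "V_space \<alpha> n = span
     ({on_Omega \<alpha> (\<lambda>(u, v, w). cos (real r * u + real g * v + real b * w)) | r g b.
         r \<in> {0..n} \<and> g \<in> {0..n} \<and> b \<in> {0..n}} \<union>
      {on_Omega \<alpha> (\<lambda>(u, v, w). sin (real r * u + real g * v + real b * w)) | r g b.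
         r \<in> {0..n} \<and> g \<in> {0..n} \<and> b \<in> {0..n}})"

text \<open>
  \<open>R_fun \<alpha> n i j\<close> is the function written \<open>R\<close> with subscripts \<open>2n, 2n - i, j\<close>, and similarly
  for \<open>G_fun\<close> and \<open>B_fun\<close>.  It is meaningful for \<open>n \<ge> 1\<close>, \<open>0 \<le> j \<le> n\<close> and
  \<open>j \<le> i \<le> 2n - j\<close>; in this range no subtraction in an exponent truncates.
\<close>

definition R_fun :: "real \<Rightarrow> nat \<Rightarrow> nat \<Rightarrow> nat \<Rightarrow> real \<times> real \<times> real \<Rightarrow> real" where
  "R_fun \<alpha> n i j = on_Omega \<alpha> (\<lambda>(u, v, w).
     if i \<le> n
     then sin (u / 2) ^ (2 * n - i) * sin (w / 2) ^ i * cos (v / 2) ^ (i - j) * sin (v / 2) ^ j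
     else sin (u / 2) ^ (2 * n - i) * sin (w / 2) ^ i * cos (v / 2) ^ (2 * n - i - j) * sin (v / 2) ^ j)"

definition G_fun :: "real \<Rightarrow> nat \<Rightarrow> nat \<Rightarrow> nat \<Rightarrow> real \<times> real \<times> real \<Rightarrow> real" where
  "G_fun \<alpha> n i j = (\<lambda>(u, v, w). R_fun \<alpha> n i j (w, u, v))"

definition B_fun :: "real \<Rightarrow> nat \<Rightarrow> nat \<Rightarrow> nat \<Rightarrow> real \<times> real \<times> real \<Rightarrow> real" where
  "B_fun \<alpha> n i j = (\<lambda>(u, v, w). R_fun \<alpha> n i j (v, w, u))"

definition T_set :: "real \<Rightarrow> nat \<Rightarrow> (real \<times> real \<times> real \<Rightarrow> real) set" where
  "T_set \<alpha> n =
     (\<Union>j\<in>{0..n - 1}. \<Union>i\<in>{j..2 * n - 1 - j}. {R_fun \<alpha> n i j, G_fun \<alpha> n i j, B_fun \<alpha> n i j})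
     \<union> {R_fun \<alpha> n n n}"

definition T_space :: "real \<Rightarrow> nat \<Rightarrow> (real \<times> real \<times> real \<Rightarrow> real) set" where
  "T_space \<alpha> n = span (T_set \<alpha> n)"

definition delta :: "nat \<Rightarrow> nat" where
  "delta n = 3 * n * (n + 1) + 1"

end

theory Submission
  imports Defs
begin

text \<open>
  Both spaces are spanned by an explicit family of \<open>delta n\<close> functions, and both families are
  linearly independent; the dimension formulas follow by arithmetic. In particular the equality
  of the two dimensions comes from counting, not from a comparison of the two spaces.

  On the triangle \<open>w = \<alpha> - u - v\<close>, so \<open>ru + gv + bw = ku + lv + b\<alpha>\<close> with \<open>k = r - b\<close> and
  \<open>l = g - b\<close>. The constant \<open>b\<alpha>\<close> merely rotates the pair \<open>(cos, sin)\<close>, so the space is spanned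
  by the cosines and sines of \<open>ku + lv\<close>, where \<open>(k, l)\<close> runs through the lattice points of the
  hexagon \<open>|k|, |l|, |k - l| \<le> n\<close>; there are \<open>delta n\<close> of them. Opposite points give the same
  two functions up to sign, so one function per point suffices
  (\<open>V_space_eq_span_trig_basis\<close>). Independence holds because the complex exponentials with these
  frequencies are independent: along a suitable line their frequencies become distinct integers,
  and a polynomial in \<open>e\<^sup>i\<^sup>t\<close> with infinitely many zeros vanishes
  (\<open>exponentials_independent_on_Omega\<close>).

  For the other family (\<open>T_total_independent\<close>), let \<open>S\<close> be the product of the sines of
  \<open>u/2\<close>, \<open>v/2\<close> and \<open>w/2\<close>. The functions with \<open>j \<ge> 1\<close> of level \<open>n + 1\<close> are exactly \<open>S\<close> times the
  functions of level \<open>n\<close>, hence vanish on the boundary of the triangle, while those with \<open>j = 0\<close>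
  restrict on each edge to a Bernstein-type basis of \<open>2(n + 1) + 1\<close> functions of one variable,
  or to zero. In a vanishing linear combination the
  edges therefore kill all coefficients with \<open>j = 0\<close>. What remains is \<open>S\<close> times a combination of
  level \<open>n\<close>, and \<open>S\<close> is positive inside the triangle, so induction finishes the argument.
\<close>

section \<open>Linear independence of families\<close>

lemma sum_scaleR_fun_apply:
  fixes f :: "'i \<Rightarrow> 'a \<Rightarrow> real"
  shows "(\<Sum>i\<in>I. c i *\<^sub>R f i) x = (\<Sum>i\<in>I. c i * f i x)"
  by (induction I rule: infinite_finite_induct) auto

lemma dim_span_independent_family:
  fixes f :: "'i \<Rightarrow> 'a::real_vector"
  assumes fin: "finite I"
    and indep: "\<And>c. (\<Sum>i\<in>I. c i *\<^sub>R f i) = 0 \<Longrightarrow> \<forall>i\<in>I. c i = 0"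
  shows "dim (span (f ` I)) = card I"
proof -
  have inj: "inj_on f I"
  proof (rule inj_onI, rule ccontr)
    fix i k assume ik: "i \<in> I" "k \<in> I" "f i = f k" "i \<noteq> k"
    let ?c = "\<lambda>m. if m = i then 1 else if m = k then -1 else (0::real)"
    have "(\<Sum>m\<in>I. ?c m *\<^sub>R f m) = (\<Sum>m\<in>{i,k}. ?c m *\<^sub>R f m)"
      using ik fin by (intro sum.mono_neutral_right) auto
    also have "\<dots> = 0" using ik by simp
    finally show False using indep[of ?c] ik by auto
  qed
  have "independent (f ` I)"
  proof (rule independent_if_scalars_zero)
    show "finite (f ` I)" using fin by simp
    fix c x assume "(\<Sum>x\<in>f ` I. c x *\<^sub>R x) = 0" and x: "x \<in> f ` I"
    then have "(\<Sum>i\<in>I. c (f i) *\<^sub>R f i) = 0"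
      by (simp add: sum.reindex[OF inj])
    from indep[OF this] x show "c x = 0" by auto
  qed
  then show ?thesis
    by (simp add: dim_eq_card_independent card_image[OF inj])
qed

text \<open>
  Both independence proofs end in this form: the frequencies, respectively the Bernstein indices,
  become distinct exponents of one variable.
\<close>

lemma sparse_polynomial_zero:
  fixes c :: "'i \<Rightarrow> 'a::idom"
  assumes fin: "finite I" and inj: "inj_on N I" and inf: "infinite Z"
    and zero: "\<And>z. z \<in> Z \<Longrightarrow> (\<Sum>i\<in>I. c i * z ^ N i) = 0"
    and i: "i \<in> I"
  shows "c i = 0"
proof -
  define P where "P = (\<Sum>k\<in>I. monom (c k) (N k))"
  have "Z \<subseteq> {z. poly P z = 0}"
    using zero by (auto simp: P_def poly_sum poly_monom)
  then have "P = 0" using inf poly_roots_finite[of P] finite_subset by blast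
  then have "0 = coeff P (N i)" by simp
  also have "\<dots> = (\<Sum>k\<in>I. if k = i then c k else 0)"
    unfolding P_def coeff_sum using inj i by (intro sum.cong) (auto dest: inj_onD)
  also have "\<dots> = c i" using fin i by simp
  finally show ?thesis by simp
qed

section \<open>The hexagon of frequencies\<close>

definition hexagon :: "nat \<Rightarrow> (int \<times> int) set" where
  "hexagon n = {(k, l). \<bar>k\<bar> \<le> int n \<and> \<bar>l\<bar> \<le> int n \<and> \<bar>k - l\<bar> \<le> int n}"

text \<open>
  The row of the hexagon at \<open>k\<close> has \<open>2n + 1 - |k|\<close> points, so this sum is what its cardinality
  needs.
\<close>

lemma sum_abs_int_interval: "(\<Sum>k\<in>{- int n..int n}. \<bar>k\<bar>) = int n * (int n + 1)"
proof (induction n)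
  case (Suc n)
  have "{- int (Suc n)..int (Suc n)} = insert (int n + 1) (insert (- int n - 1) {- int n..int n})"
    by auto
  then show ?case using Suc by (simp add: algebra_simps)
qed simp

lemma hexagon_eq_Sigma:
  "hexagon n = (SIGMA k:{- int n..int n}. {max (- int n) (k - int n)..min (int n) (k + int n)})"
  by (auto simp: hexagon_def)

lemma finite_hexagon [simp]: "finite (hexagon n)"
  by (simp add: hexagon_eq_Sigma)

lemma card_hexagon: "card (hexagon n) = delta n"
proof -
  have "int (card (hexagon n))
      = (\<Sum>k\<in>{- int n..int n}. int (card {max (- int n) (k - int n)..min (int n) (k + int n)}))"
    by (simp add: hexagon_eq_Sigma)
  also have "\<dots> = (\<Sum>k\<in>{- int n..int n}. (2 * int n + 1) - \<bar>k\<bar>)"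
    by (intro sum.cong) auto
  also have "\<dots> = (2 * int n + 1) * (2 * int n + 1) - int n * (int n + 1)"
    by (simp add: sum_subtractf sum_abs_int_interval)
  also have "\<dots> = int (delta n)"
    by (simp add: delta_def algebra_simps)
  finally show ?thesis by simp
qed

lemma uminus_mem_hexagon [simp]: "- p \<in> hexagon n \<longleftrightarrow> p \<in> hexagon n"
  by (cases p) (auto simp: hexagon_def)

definition phase :: "int \<times> int \<Rightarrow> real \<times> real \<times> real \<Rightarrow> real" where
  "phase p q = of_int (fst p) * fst q + of_int (snd p) * fst (snd q)"

lemma phase_uminus [simp]: "phase (- p) q = - phase p q"
  by (simp add: phase_def)

lemma phase_zero [simp]: "phase 0 q = 0"
  by (simp add: phase_def)

text \<open>
  The line through \<open>(\<alpha>/4, \<alpha>/4)\<close> in direction \<open>(2n + 1, 1)\<close> stays in the triangle for a short time.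
  Along it the frequency \<open>(k, l)\<close> becomes the integer \<open>(2n + 1)k + l\<close>, which determines \<open>k\<close> and \<open>l\<close>
  because \<open>|l| \<le> n\<close>. After multiplication by a common exponential the sum is a polynomial in
  \<open>e\<^sup>i\<^sup>t\<close> with one term for each frequency and infinitely many zeros.
\<close>

lemma exponentials_independent_on_Omega:
  fixes d :: "int \<times> int \<Rightarrow> complex"
  assumes "0 < \<alpha>"
    and zero: "\<And>q. q \<in> Omega \<alpha> \<Longrightarrow> (\<Sum>p\<in>hexagon n. d p * cis (phase p q)) = 0"
    and p: "p \<in> hexagon n"
  shows "d p = 0"
proof -
  define M where "M = 2 * int n + 1"
  \<comment> \<open>\<open>- D\<close> is a lower bound for \<open>M k + l\<close> on the hexagon; adding \<open>D\<close> makes the exponents natural.\<close>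
  define D where "D = M * int n + int n"
  define N where "N p = M * fst p + snd p + D" for p :: "int \<times> int"
  define \<theta> where "\<theta> p = (real_of_int (fst p) + real_of_int (snd p)) * \<alpha> / 4" for p :: "int \<times> int"
  \<comment> \<open>The second bound keeps the line inside the triangle; the bound 1 makes \<open>cis\<close> injective on it.\<close>
  define \<epsilon> where "\<epsilon> = min 1 (\<alpha> / (4 * (real n + 1)))"
  have \<epsilon>: "0 < \<epsilon>" using \<open>0 < \<alpha>\<close> by (simp add: \<epsilon>_def)
  have N_nonneg: "0 \<le> N p" if "p \<in> hexagon n" for p
  proof -
    have "M * (- int n) \<le> M * fst p"
      using that by (intro mult_left_mono) (auto simp: hexagon_def M_def)
    then show ?thesis using that by (auto simp: N_def D_def hexagon_def)
  qed
  have inj: "inj_on (\<lambda>p. nat (N p)) (hexagon n)"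
  proof (rule inj_onI)
    fix p q assume p: "p \<in> hexagon n" and q: "q \<in> hexagon n" and "nat (N p) = nat (N q)"
    then have "N p = N q" using N_nonneg by (metis nat_eq_iff)
    then have eq: "M * (fst p - fst q) = snd q - snd p" by (simp add: N_def algebra_simps)
    have "\<bar>snd q - snd p\<bar> < M" using p q by (auto simp: hexagon_def M_def)
    moreover have "M dvd snd q - snd p" using eq by (metis dvd_triv_left)
    ultimately have "snd q - snd p = 0" using dvd_imp_le_int[of "snd q - snd p" M] by linarith
    with eq show "p = q" by (auto simp: M_def prod_eq_iff)
  qed
  have inf: "infinite (cis ` {0<..<\<epsilon>})"
  proof -
    have "inj_on cis {0<..<\<epsilon>}"
    proof (rule inj_onI)
      fix s t assume st: "s \<in> {0<..<\<epsilon>}" "t \<in> {0<..<\<epsilon>}" "cis s = cis t"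
      then have "cos s = cos t" by (metis cis.sel(1))
      moreover have "s \<le> pi" "t \<le> pi" using st pi_gt3 by (auto simp: \<epsilon>_def)
      ultimately show "s = t" using st cos_inj_pi by auto
    qed
    then show ?thesis using \<epsilon> by (simp add: finite_image_iff infinite_Ioo)
  qed
  have "d p * cis (\<theta> p) = 0"
  proof (rule sparse_polynomial_zero[OF finite_hexagon inj inf _ p, where c = "\<lambda>p. d p * cis (\<theta> p)"])
    fix z assume "z \<in> cis ` {0<..<\<epsilon>}"
    then obtain t where t: "0 < t" "t < \<epsilon>" and z: "z = cis t" by auto
    define u v where "u = \<alpha> / 4 + real_of_int M * t" and "v = \<alpha> / 4 + t"
    define m where "m = real n * t"
    have "t * (4 * (real n + 1)) \<le> \<alpha>"
      using t by (simp add: \<epsilon>_def pos_less_divide_eq)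
    then have "4 * m + 4 * t \<le> \<alpha>" by (simp add: m_def algebra_simps)
    moreover have "0 \<le> m" using t by (simp add: m_def)
    moreover have "u = \<alpha> / 4 + 2 * m + t" by (simp add: u_def M_def m_def algebra_simps)
    ultimately have q: "(u, v, \<alpha> - u - v) \<in> Omega \<alpha>"
      using t \<open>0 < \<alpha>\<close> by (simp add: Omega_def v_def)
    have *: "d p * cis (\<theta> p) * z ^ nat (N p)
        = cis (of_int D * t) * (d p * cis (phase p (u, v, \<alpha> - u - v)))" if "p \<in> hexagon n" for p
    proof -
      have "z ^ nat (N p) = cis (of_int (N p) * t)"
        unfolding z Complex.DeMoivre using N_nonneg[OF that] by (simp only: of_nat_nat)
      moreover have "\<theta> p + of_int (N p) * t = of_int D * t + phase p (u, v, \<alpha> - u - v)"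
        by (simp add: \<theta>_def N_def phase_def u_def v_def field_simps)
      ultimately show ?thesis by (simp add: cis_mult mult.assoc mult.left_commute)
    qed
    have "(\<Sum>p\<in>hexagon n. d p * cis (\<theta> p) * z ^ nat (N p))
        = cis (of_int D * t) * (\<Sum>p\<in>hexagon n. d p * cis (phase p (u, v, \<alpha> - u - v)))"
      unfolding sum_distrib_left by (intro sum.cong refl *)
    then show "(\<Sum>p\<in>hexagon n. d p * cis (\<theta> p) * z ^ nat (N p)) = 0"
      using zero[OF q] by simp
  qed
  then show ?thesis by simp
qed

section \<open>The dimension of the space of trigonometric polynomials\<close>

text \<open>
  Exactly one of two opposite nonzero frequencies is nonnegative in the lexicographic order. It
  carries the cosine and the other one carries the sine, so that the basis is indexed by the
  hexagon itself; the origin carries the constant 1.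
\<close>

definition lex_nonneg :: "int \<times> int \<Rightarrow> bool" where
  "lex_nonneg p \<longleftrightarrow> fst p > 0 \<or> (fst p = 0 \<and> snd p \<ge> 0)"

lemma lex_nonneg_uminus: "p \<noteq> 0 \<Longrightarrow> lex_nonneg (- p) \<longleftrightarrow> \<not> lex_nonneg p"
  by (cases p) (auto simp: lex_nonneg_def zero_prod_def)

definition trig_basis :: "real \<Rightarrow> int \<times> int \<Rightarrow> real \<times> real \<times> real \<Rightarrow> real" where
  "trig_basis \<alpha> p = on_Omega \<alpha> (\<lambda>q. if lex_nonneg p then cos (phase p q) else sin (phase p q))"

text \<open>
  Expanding cosine and sine into exponentials and replacing \<open>p\<close> by \<open>- p\<close> in the conjugate half
  gives a combination of exponentials whose coefficient at \<open>p\<close> mixes \<open>a p\<close> and \<open>a (- p)\<close>. For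
  nonzero \<open>p\<close> carrying a cosine it is \<open>(a p + \<i> a (- p)) / 2\<close>, whose real and imaginary parts
  recover both.
\<close>

lemma trig_basis_independent:
  assumes "0 < \<alpha>" and zero: "(\<Sum>p\<in>hexagon n. a p *\<^sub>R trig_basis \<alpha> p) = 0"
  shows "\<forall>p\<in>hexagon n. a p = 0"
proof -
  \<comment> \<open>The basis function at \<open>p\<close> is \<open>\<kappa> p cis(x) + \<kappa>' p cis(-x)\<close> with \<open>x\<close> the phase.\<close>
  define \<kappa> \<kappa>' :: "int \<times> int \<Rightarrow> complex"
    where "\<kappa> p = (if lex_nonneg p then 1 / 2 else - \<i> / 2)"
      and "\<kappa>' p = (if lex_nonneg p then 1 / 2 else \<i> / 2)" for p
  define d where "d p = of_real (a p) * \<kappa> p + of_real (a (- p)) * \<kappa>' (- p)" for p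
  have d0: "d p = 0" if p: "p \<in> hexagon n" for p
  proof (rule exponentials_independent_on_Omega[OF \<open>0 < \<alpha>\<close> _ p])
    fix q assume q: "q \<in> Omega \<alpha>"
    have split: "complex_of_real (a p * trig_basis \<alpha> p q)
        = of_real (a p) * \<kappa> p * cis (phase p q) + of_real (a p) * \<kappa>' p * cis (phase (- p) q)" for p
      using q by (auto simp: trig_basis_def on_Omega_def \<kappa>_def \<kappa>'_def complex_eq_iff)
    have reflect: "(\<Sum>p\<in>hexagon n. of_real (a p) * \<kappa>' p * cis (phase (- p) q))
        = (\<Sum>p\<in>hexagon n. of_real (a (- p)) * \<kappa>' (- p) * cis (phase p q))"
      by (rule sum.reindex_bij_witness[of _ uminus uminus]) auto
    have "0 = complex_of_real (\<Sum>p\<in>hexagon n. a p * trig_basis \<alpha> p q)"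
      using fun_cong[OF zero, of q] by (simp add: sum_scaleR_fun_apply)
    also have "\<dots> = (\<Sum>p\<in>hexagon n. d p * cis (phase p q))"
      by (simp only: of_real_sum split sum.distrib reflect d_def distrib_right)
    finally show "(\<Sum>p\<in>hexagon n. d p * cis (phase p q)) = 0" by simp
  qed
  have pos: "a p = 0 \<and> a (- p) = 0" if p: "p \<in> hexagon n" "lex_nonneg p" for p
  proof (cases "p = 0")
    case True
    then show ?thesis using d0[OF p(1)] p(2) by (simp add: d_def \<kappa>_def \<kappa>'_def complex_eq_iff)
  next
    case False
    then show ?thesis using d0[OF p(1)] p(2) lex_nonneg_uminus[of p]
      by (simp add: d_def \<kappa>_def \<kappa>'_def complex_eq_iff)
  qed
  show ?thesis
  proof
    fix p assume p: "p \<in> hexagon n"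
    show "a p = 0"
    proof (cases "lex_nonneg p")
      case True
      then show ?thesis using pos p by simp
    next
      case False
      then have "lex_nonneg (- p)" by (auto simp: lex_nonneg_def)
      then show ?thesis using pos[of "- p"] p by simp
    qed
  qed
qed

lemma on_Omega_combination:
  assumes "on_Omega \<alpha> f \<in> span B" "on_Omega \<alpha> g \<in> span B"
    and "\<And>q. q \<in> Omega \<alpha> \<Longrightarrow> h q = x * f q + y * g q"
  shows "on_Omega \<alpha> h \<in> span B"
proof -
  have "on_Omega \<alpha> h = x *\<^sub>R on_Omega \<alpha> f + y *\<^sub>R on_Omega \<alpha> g"
    using assms(3) by (auto simp: on_Omega_def fun_eq_iff)
  then show ?thesis using assms(1,2) by (simp add: span_add span_scale)
qed

lemma cos_sin_phase_mem_span_trig_basis: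
  assumes p: "p \<in> hexagon n"
  shows "on_Omega \<alpha> (\<lambda>q. cos (phase p q)) \<in> span (trig_basis \<alpha> ` hexagon n)"
    and "on_Omega \<alpha> (\<lambda>q. sin (phase p q)) \<in> span (trig_basis \<alpha> ` hexagon n)"
proof -
  let ?B = "trig_basis \<alpha> ` hexagon n"
  have basis: "trig_basis \<alpha> p \<in> span ?B" "trig_basis \<alpha> (- p) \<in> span ?B"
    using p by (auto intro!: span_base imageI)
  have "on_Omega \<alpha> (\<lambda>q. cos (phase p q)) = trig_basis \<alpha> (if lex_nonneg p then p else - p)"
    by (auto simp: trig_basis_def on_Omega_def lex_nonneg_def fun_eq_iff)
  then show "on_Omega \<alpha> (\<lambda>q. cos (phase p q)) \<in> span ?B"
    using basis by simp
  have "on_Omega \<alpha> (\<lambda>q. sin (phase p q))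
      = (if p = 0 then 0 else if lex_nonneg p then - trig_basis \<alpha> (- p) else trig_basis \<alpha> p)"
    using lex_nonneg_uminus[of p] by (auto simp: trig_basis_def on_Omega_def fun_eq_iff)
  then show "on_Omega \<alpha> (\<lambda>q. sin (phase p q)) \<in> span ?B"
    using basis by (simp add: span_neg span_zero)
qed

text \<open>
  The addition theorems turn the phase shift \<open>b\<alpha>\<close> into a linear combination, in both directions.
\<close>

lemma V_space_eq_span_trig_basis: "V_space \<alpha> n = span (trig_basis \<alpha> ` hexagon n)"
proof -
  define X where "X r g b = (\<lambda>(u, v, w). real r * u + real g * v + real b * w)" for r g b :: nat
  define Gc where "Gc = {on_Omega \<alpha> (\<lambda>q. cos (X r g b q)) | r g b.
      r \<in> {0..n} \<and> g \<in> {0..n} \<and> b \<in> {0..n}}"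
  define Gs where "Gs = {on_Omega \<alpha> (\<lambda>q. sin (X r g b q)) | r g b.
      r \<in> {0..n} \<and> g \<in> {0..n} \<and> b \<in> {0..n}}"
  have V: "V_space \<alpha> n = span (Gc \<union> Gs)"
    by (simp add: V_space_def Gc_def Gs_def X_def case_prod_unfold)
  have X: "X r g b q = phase (int r - int b, int g - int b) q + real b * \<alpha>" if "q \<in> Omega \<alpha>" for r g b q
    using that by (auto simp: X_def phase_def Omega_def algebra_simps)
  have "f \<in> span (trig_basis \<alpha> ` hexagon n)" if f: "f \<in> Gc \<union> Gs" for f
  proof -
    obtain r g b where rgb: "r \<le> n" "g \<le> n" "b \<le> n"
      and f: "f = on_Omega \<alpha> (\<lambda>q. cos (X r g b q)) \<or> f = on_Omega \<alpha> (\<lambda>q. sin (X r g b q))"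
      using f by (auto simp: Gc_def Gs_def)
    have "(int r - int b, int g - int b) \<in> hexagon n" using rgb by (auto simp: hexagon_def)
    note cs = cos_sin_phase_mem_span_trig_basis[OF this, of \<alpha>]
    have "on_Omega \<alpha> (\<lambda>q. cos (X r g b q)) \<in> span (trig_basis \<alpha> ` hexagon n)"
      by (rule on_Omega_combination[OF cs, where x = "cos (real b * \<alpha>)" and y = "- sin (real b * \<alpha>)"])
        (simp add: X cos_add)
    moreover have "on_Omega \<alpha> (\<lambda>q. sin (X r g b q)) \<in> span (trig_basis \<alpha> ` hexagon n)"
      by (rule on_Omega_combination[OF cs, where x = "sin (real b * \<alpha>)" and y = "cos (real b * \<alpha>)"])
        (simp add: X sin_add)
    ultimately show ?thesis using f by auto
  qed
  moreover have "trig_basis \<alpha> p \<in> span (Gc \<union> Gs)" if p: "p \<in> hexagon n" for p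
  proof -
    obtain k l where kl: "p = (k, l)" by (cases p)
    \<comment> \<open>The least shift making \<open>r = k + b\<close> and \<open>g = l + b\<close> natural; the three inequalities of the
      hexagon say that \<open>r\<close>, \<open>g\<close> and \<open>b\<close> are then at most \<open>n\<close>.\<close>
    define b where "b = nat (max 0 (max (- k) (- l)))"
    define r g where "r = nat (k + int b)" and "g = nat (l + int b)"
    have rgb: "r \<le> n" "g \<le> n" "b \<le> n" "k = int r - int b" "l = int g - int b"
      using p by (auto simp: hexagon_def kl r_def g_def b_def)
    have c: "on_Omega \<alpha> (\<lambda>q. cos (X r g b q)) \<in> span (Gc \<union> Gs)"
      using rgb by (intro span_base) (auto simp: Gc_def)
    have s: "on_Omega \<alpha> (\<lambda>q. sin (X r g b q)) \<in> span (Gc \<union> Gs)"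
      using rgb by (intro span_base) (auto simp: Gs_def)
    have ph: "phase p q = X r g b q - real b * \<alpha>" if "q \<in> Omega \<alpha>" for q
      using X[OF that, of r g b] rgb by (simp add: kl)
    show ?thesis
    proof (cases "lex_nonneg p")
      case True
      then show ?thesis unfolding trig_basis_def
        by (intro on_Omega_combination[OF c s, where x = "cos (real b * \<alpha>)" and y = "sin (real b * \<alpha>)"])
          (simp add: ph cos_diff)
    next
      case False
      then show ?thesis unfolding trig_basis_def
        by (intro on_Omega_combination[OF c s, where x = "- sin (real b * \<alpha>)" and y = "cos (real b * \<alpha>)"])
          (simp add: ph sin_diff)
    qed
  qed
  ultimately have "Gc \<union> Gs \<subseteq> span (trig_basis \<alpha> ` hexagon n)"
    and "trig_basis \<alpha> ` hexagon n \<subseteq> span (Gc \<union> Gs)" by blast+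
  then show ?thesis unfolding V by (simp only: span_eq)
qed

lemma dim_V_space: "0 < \<alpha> \<Longrightarrow> dim (V_space \<alpha> n) = delta n"
  unfolding V_space_eq_span_trig_basis card_hexagon[symmetric]
  by (rule dim_span_independent_family) (simp_all add: trig_basis_independent)

section \<open>The dimension of the span of the Bernstein-like system\<close>

text \<open>
  The generating functions without the cut-off outside the triangle. They are continuous on the
  whole space, which is what lets identities pass from the interior to the edges. The two cases
  of the definition differ only in the exponent of the cosine.
\<close>

definition R_total :: "nat \<Rightarrow> nat \<Rightarrow> nat \<Rightarrow> real \<times> real \<times> real \<Rightarrow> real" where
  "R_total n i j = (\<lambda>(u, v, w). sin (u / 2) ^ (2 * n - i) * sin (w / 2) ^ i
     * cos (v / 2) ^ (if i \<le> n then i - j else 2 * n - i - j) * sin (v / 2) ^ j)"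

text \<open>
  The functions \<open>G\<close> and \<open>B\<close> arise from \<open>R\<close> by one and two of these rotations, so each of the
  three edges can be treated as the edge \<open>v = 0\<close>.
\<close>

definition rot :: "real \<times> real \<times> real \<Rightarrow> real \<times> real \<times> real" where
  "rot = (\<lambda>(u, v, w). (w, u, v))"

lemma rot_simp [simp]: "rot (u, v, w) = (w, u, v)"
  by (simp add: rot_def)

definition sine_product :: "real \<times> real \<times> real \<Rightarrow> real" where
  "sine_product = (\<lambda>(u, v, w). sin (u / 2) * sin (v / 2) * sin (w / 2))"

lemma sine_product_rot_power [simp]: "sine_product ((rot ^^ s) q) = sine_product q"
proof (induction s)
  case (Suc s)
  have "sine_product (rot x) = sine_product x" for x
    by (cases x) (simp add: sine_product_def)
  with Suc show ?case by simp
qed simp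

text \<open>
  This is the recursion behind the induction: raising \<open>n\<close>, \<open>i\<close> and \<open>j\<close> together leaves the exponent
  of the cosine unchanged and raises each of the three sine exponents by one.
\<close>

lemma R_total_Suc:
  assumes "j \<le> i" "i + j \<le> 2 * n"
  shows "R_total (Suc n) (Suc i) (Suc j) q = sine_product q * R_total n i j q"
proof -
  have "2 * Suc n - Suc i = Suc (2 * n - i)" "2 * Suc n - Suc i - Suc j = 2 * n - i - j"
    using assms by auto
  then show ?thesis by (cases q) (simp add: R_total_def sine_product_def)
qed

lemma continuous_on_R_total: "continuous_on UNIV (R_total n i j)"
  unfolding R_total_def case_prod_unfold by (intro continuous_intros) auto

lemma continuous_on_rot_power: "continuous_on UNIV (rot ^^ s)"
proof (induction s)
  case (Suc s)
  have "continuous_on UNIV rot"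
    unfolding rot_def case_prod_unfold by (intro continuous_intros)
  from continuous_on_compose2[OF this Suc] show ?case
    by (simp add: o_def)
qed (simp add: continuous_on_id)

text \<open>
  On the edge \<open>v = 0\<close> the function of index \<open>i\<close> becomes \<open>sin\<^bsup>2n-i\<^esup>(u/2) sin\<^sup>i((\<alpha>-u)/2)\<close>. Its first
  rotation contains \<open>sin\<^sup>i(v/2)\<close> and survives only for \<open>i = 0\<close>, where it supplies the missing
  function of index \<open>2n\<close>; its second rotation contains \<open>sin\<^bsup>2n-i\<^esup>(v/2)\<close> and vanishes. Division by
  \<open>sin\<^bsup>2n\<^esup>(u/2)\<close> leaves a polynomial in the quotient \<open>\<tau>\<close> of the two sines, which takes
  infinitely many values.
\<close>

lemma edge_independent:
  assumes \<alpha>: "0 < \<alpha>" "\<alpha> < pi" and n: "n \<ge> 1" and i: "i < 2 * n"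
    and zero: "\<And>u. 0 < u \<Longrightarrow> u < \<alpha> \<Longrightarrow>
      (\<Sum>i<2*n. c0 i * R_total n i 0 (u, 0, \<alpha> - u))
        + (\<Sum>i<2*n. c1 i * R_total n i 0 (rot (u, 0, \<alpha> - u)))
        + (\<Sum>i<2*n. c2 i * R_total n i 0 (rot (rot (u, 0, \<alpha> - u)))) = 0"
  shows "c0 i = 0"
proof -
  define \<tau> where "\<tau> u = sin ((\<alpha> - u) / 2) / sin (u / 2)" for u
  define c where "c i = (if i < 2 * n then c0 i else c1 0)" for i
  have sin_pos: "0 < sin (u / 2)" if "0 < u" "u < \<alpha>" for u
    using that \<alpha> by (intro sin_gt_zero) auto
  have "inj_on \<tau> {0<..<\<alpha>}"
  proof (rule inj_onI)
    fix x y assume xy: "x \<in> {0<..<\<alpha>}" "y \<in> {0<..<\<alpha>}" "\<tau> x = \<tau> y"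
    then have "sin ((\<alpha> - x) / 2) * sin (y / 2) = sin ((\<alpha> - y) / 2) * sin (x / 2)"
      using sin_pos[of x] sin_pos[of y] by (simp add: \<tau>_def field_simps)
    then have "sin (\<alpha> / 2) * sin (y / 2 - x / 2) = 0"
      unfolding sin_diff diff_divide_distrib by (simp add: algebra_simps)
    moreover have "sin (\<alpha> / 2) > 0" using \<alpha> by (intro sin_gt_zero) auto
    ultimately have "sin (y / 2 - x / 2) = 0" by simp
    moreover have "\<bar>y / 2 - x / 2\<bar> < pi" using xy \<alpha> by (auto simp: abs_if)
    ultimately show "x = y" using sin_eq_0_pi[of "y / 2 - x / 2"] by (simp add: abs_less_iff)
  qed
  then have inf: "infinite (\<tau> ` {0<..<\<alpha>})"
    using \<alpha> by (simp add: finite_image_iff infinite_Ioo)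
  have "c i = 0"
  proof (rule sparse_polynomial_zero[where I = "{..2 * n}" and N = "\<lambda>i. i", OF _ _ inf])
    fix z assume "z \<in> \<tau> ` {0<..<\<alpha>}"
    then obtain u where u: "0 < u" "u < \<alpha>" and z: "z = \<tau> u" by auto
    let ?s = "sin (u / 2)" and ?t = "sin ((\<alpha> - u) / 2)"
    have pow: "?s ^ (2 * n - i) * ?t ^ i = ?s ^ (2 * n) * z ^ i" if "i \<le> 2 * n" for i
      using that sin_pos[OF u] by (simp add: z \<tau>_def power_divide power_diff)
    have terms: "c0 i * R_total n i 0 (u, 0, \<alpha> - u) + c1 i * R_total n i 0 (rot (u, 0, \<alpha> - u))
        + c2 i * R_total n i 0 (rot (rot (u, 0, \<alpha> - u)))
        = ?s ^ (2 * n) * (c i * z ^ i) + (if i = 0 then c1 0 * ?t ^ (2 * n) else 0)"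
      if "i < 2 * n" for i
      using pow[of i] that by (auto simp: R_total_def c_def power_0_left)
    have "0 = (\<Sum>i<2*n. c0 i * R_total n i 0 (u, 0, \<alpha> - u)
        + c1 i * R_total n i 0 (rot (u, 0, \<alpha> - u))
        + c2 i * R_total n i 0 (rot (rot (u, 0, \<alpha> - u))))"
      unfolding sum.distrib using zero[OF u] by (rule sym)
    also have "\<dots> = (\<Sum>i<2*n. ?s ^ (2 * n) * (c i * z ^ i) + (if i = 0 then c1 0 * ?t ^ (2 * n) else 0))"
      by (intro sum.cong refl terms) simp
    also have "\<dots> = ?s ^ (2 * n) * (\<Sum>i<2*n. c i * z ^ i) + c1 0 * ?t ^ (2 * n)"
      using n by (simp add: sum.distrib sum_distrib_left)
    also have "\<dots> = ?s ^ (2 * n) * (\<Sum>i\<le>2*n. c i * z ^ i)"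
      using pow[of "2 * n"] by (simp add: lessThan_Suc_atMost[symmetric] c_def algebra_simps)
    finally show "(\<Sum>i\<le>2*n. c i * z ^ i) = 0" using sin_pos[OF u] by simp
  qed (use i in auto)
  then show ?thesis using i by (simp add: c_def)
qed

text \<open>
  The entry \<open>s\<close> is the number of rotations. The last triple stands for the single function
  \<open>R\<close> with \<open>i = j = n\<close>; for \<open>n = 0\<close> it is the only index and gives the constant 1, so the induction
  can start there.
\<close>

definition T_index :: "nat \<Rightarrow> (nat \<times> nat \<times> nat) set" where
  "T_index n = {(s, j, i). s < 3 \<and> j < n \<and> j \<le> i \<and> i + j < 2 * n} \<union> {(0, n, n)}"

definition T_total :: "nat \<Rightarrow> nat \<times> nat \<times> nat \<Rightarrow> real \<times> real \<times> real \<Rightarrow> real" where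
  "T_total n = (\<lambda>(s, j, i) q. R_total n i j ((rot ^^ s) q))"

lemma finite_T_index [simp]: "finite (T_index n)"
proof (rule finite_subset)
  show "T_index n \<subseteq> {..3} \<times> {..n} \<times> {..2 * n}" by (auto simp: T_index_def)
qed simp

definition shift :: "nat \<times> nat \<times> nat \<Rightarrow> nat \<times> nat \<times> nat" where
  "shift = (\<lambda>(s, j, i). (s, Suc j, Suc i))"

lemma inj_shift: "inj shift"
  by (auto simp: inj_on_def shift_def)

lemma T_index_Suc:
  "T_index (Suc n) = {..<3} \<times> {0} \<times> {..<2 * Suc n} \<union> shift ` T_index n"
proof (intro equalityI subsetI)
  fix x assume x: "x \<in> T_index (Suc n)"
  obtain s j i where sji: "x = (s, j, i)" by (cases x)
  show "x \<in> {..<3} \<times> {0} \<times> {..<2 * Suc n} \<union> shift ` T_index n"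
  proof (cases j)
    case 0
    then show ?thesis using x by (auto simp: sji T_index_def)
  next
    case (Suc j')
    then have "x = shift (s, j', i - 1)" "(s, j', i - 1) \<in> T_index n"
      using x by (auto simp: sji T_index_def shift_def)
    then show ?thesis by blast
  qed
qed (auto simp: T_index_def shift_def)

lemma sum_T_index_Suc:
  "(\<Sum>x\<in>T_index (Suc n). f x)
    = (\<Sum>s<3. \<Sum>i<2 * Suc n. f (s, 0, i)) + (\<Sum>x\<in>T_index n. f (shift x))"
proof -
  have "(\<Sum>x\<in>T_index (Suc n). f x)
      = (\<Sum>x\<in>{..<3} \<times> {0} \<times> {..<2 * Suc n}. f x) + (\<Sum>x\<in>shift ` T_index n. f x)"
    unfolding T_index_Suc by (intro sum.union_disjoint) (auto simp: shift_def)
  moreover have "(\<Sum>x\<in>shift ` T_index n. f x) = (\<Sum>x\<in>T_index n. f (shift x))"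
    by (subst sum.reindex) (auto intro: inj_on_subset[OF inj_shift])
  moreover have "(\<Sum>x\<in>{..<3} \<times> {0} \<times> {..<2 * Suc n}. f x) = (\<Sum>s<3. \<Sum>i<2 * Suc n. f (s, 0, i))"
    by (simp add: sum.cartesian_product' del: mult_Suc_right)
  ultimately show ?thesis by simp
qed

lemma card_T_index: "card (T_index n) = delta n"
proof (induction n)
  case 0
  have "T_index 0 = {(0, 0, 0)}" by (auto simp: T_index_def)
  then show ?case by (simp add: delta_def)
next
  case (Suc n)
  have "card (T_index (Suc n)) = 3 * (2 * Suc n) + card (T_index n)"
    using sum_T_index_Suc[of "\<lambda>_. 1 :: nat" n] by simp
  then show ?case using Suc by (simp add: delta_def algebra_simps)
qed

lemma T_total_shift:
  "x \<in> T_index n \<Longrightarrow> T_total (Suc n) (shift x) q = sine_product q * T_total n x q"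
  by (auto simp: T_index_def T_total_def shift_def R_total_Suc)

lemma continuous_on_T_total: "continuous_on UNIV (T_total n x)"
proof (cases x)
  case (fields s j i)
  have "continuous_on UNIV (R_total n i j \<circ> (rot ^^ s))"
    by (intro continuous_on_compose continuous_on_rot_power
        continuous_on_subset[OF continuous_on_R_total]) auto
  then show ?thesis by (simp add: fields T_total_def o_def)
qed

text \<open>
  The hypothesis concerns interior points only, because division by the product of the sines
  is possible only there. The edges, where the layer \<open>j = 0\<close> is isolated, are reached by
  continuity.
\<close>

lemma T_total_independent:
  assumes \<alpha>: "0 < \<alpha>" "\<alpha> < pi"
    and zero: "\<And>u v w. 0 < u \<Longrightarrow> 0 < v \<Longrightarrow> 0 < w \<Longrightarrow> u + v + w = \<alpha> \<Longrightarrow>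
      (\<Sum>x\<in>T_index n. c x * T_total n x (u, v, w)) = 0"
  shows "\<forall>x\<in>T_index n. c x = 0"
  using zero
proof (induction n arbitrary: c)
  case 0
  have "(\<Sum>x\<in>T_index 0. c x * T_total 0 x (\<alpha>/3, \<alpha>/3, \<alpha>/3)) = 0"
    using \<alpha> by (intro "0.prems") auto
  moreover have "T_index 0 = {(0, 0, 0)}" by (auto simp: T_index_def)
  ultimately show ?case by (simp add: T_total_def R_total_def)
next
  case (Suc n)
  define f where "f q = (\<Sum>x\<in>T_index (Suc n). c x * T_total (Suc n) x q)" for q
  define rest where "rest q = (\<Sum>x\<in>T_index n. c (shift x) * T_total n x q)" for q
  have f_split: "f q = (\<Sum>s<3. \<Sum>i<2 * Suc n. c (s, 0, i) * R_total (Suc n) i 0 ((rot ^^ s) q))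
      + sine_product q * rest q" for q
  proof -
    have "(\<Sum>x\<in>T_index n. c (shift x) * T_total (Suc n) (shift x) q) = sine_product q * rest q"
      unfolding rest_def sum_distrib_left by (intro sum.cong) (simp_all add: T_total_shift)
    then show ?thesis
      unfolding f_def sum_T_index_Suc by (simp only: T_total_def prod.case)
  qed
  have cont: "continuous_on UNIV f"
    unfolding f_def by (intro continuous_intros continuous_on_T_total)
  have f_edge: "f ((rot ^^ s) (u, 0, \<alpha> - u)) = 0" if u: "0 < u" "u < \<alpha>" for u s
  proof -
    \<comment> \<open>A segment that starts at the edge point and runs through the interior.\<close>
    let ?h = "\<lambda>t. f ((rot ^^ s) (u, t, \<alpha> - u - t))"
    have inner: "?h t = 0" if t: "t \<in> {0<..<\<alpha> - u}" for t
    proof -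
      obtain u' v' w' where eq: "(rot ^^ s) (u, t, \<alpha> - u - t) = (u', v', w')"
        by (metis prod_cases3)
      have "0 < u' \<and> 0 < v' \<and> 0 < w' \<and> u' + v' + w' = \<alpha>"
        using eq
      proof (induction s arbitrary: u' v' w')
        case 0
        then show ?case using u t by auto
      next
        case (Suc s)
        obtain x y z where xyz: "(rot ^^ s) (u, t, \<alpha> - u - t) = (x, y, z)" by (metis prod_cases3)
        show ?case using Suc.IH[OF xyz] Suc.prems xyz by auto
      qed
      then show ?thesis unfolding eq f_def by (intro Suc.prems) auto
    qed
    have "continuous_on UNIV (f \<circ> ((rot ^^ s) \<circ> (\<lambda>t. (u, t, \<alpha> - u - t))))"
      by (intro continuous_on_compose continuous_on_subset[OF cont]
          continuous_on_subset[OF continuous_on_rot_power] continuous_intros) auto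
    then have h: "continuous_on (closure {0<..<\<alpha> - u}) ?h"
      by (auto simp: o_def intro: continuous_on_subset)
    have "0 \<in> closure {0<..<\<alpha> - u}" using u by simp
    with h inner have "?h 0 = 0" by (rule continuous_constant_on_closure)
    then show ?thesis by simp
  qed
  define C where "C s i = c (s, 0, i)" for s i
  define row where "row k q = (\<Sum>i<2 * Suc n. C k i * R_total (Suc n) i 0 q)" for k q
  have f_rows: "f q = row 0 q + row 1 (rot q) + row 2 (rot (rot q)) + sine_product q * rest q" for q
    unfolding f_split row_def C_def
    by (simp add: numeral_3_eq_3 numeral_2_eq_2 del: mult_Suc_right rot_simp)
  have edge: "row 0 ((rot ^^ s) q) + row 1 (rot ((rot ^^ s) q)) + row 2 (rot (rot ((rot ^^ s) q))) = 0"
    if q: "q = (u, 0, \<alpha> - u)" and u: "0 < u" "u < \<alpha>" for s q u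
  proof -
    have "sine_product q = 0" by (simp add: q sine_product_def)
    then show ?thesis
      using f_edge[OF u, of s] unfolding f_rows q[symmetric] sine_product_rot_power by simp
  qed
  have rot3: "rot (rot (rot q)) = q" for q by (cases q) simp
  \<comment> \<open>Rotating the point by 0, 1 or 2 steps permutes the three rows cyclically, so each of them in
    turn plays the main part on the edge \<open>v = 0\<close>.\<close>
  have layer0: "C s i = 0" if "s < 3" and i: "i < 2 * Suc n" for s i
  proof -
    have "row 0 q + row 1 (rot q) + row 2 (rot (rot q)) = 0"
      and "row 1 q + row 2 (rot q) + row 0 (rot (rot q)) = 0"
      and "row 2 q + row 0 (rot q) + row 1 (rot (rot q)) = 0"
      if q: "q = (u, 0, \<alpha> - u)" and u: "0 < u" "u < \<alpha>" for q u
    proof -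
      have "(rot ^^ 0) q = q" "(rot ^^ 1) q = rot q" "(rot ^^ 2) q = rot (rot q)"
        by (simp_all add: numeral_2_eq_2)
      then show "row 0 q + row 1 (rot q) + row 2 (rot (rot q)) = 0"
        "row 1 q + row 2 (rot q) + row 0 (rot (rot q)) = 0"
        "row 2 q + row 0 (rot q) + row 1 (rot (rot q)) = 0"
        using edge[OF q u, of 0] edge[OF q u, of 1] edge[OF q u, of 2] by (simp_all add: rot3)
    qed
    note rows = this[OF refl, unfolded row_def]
    have n: "1 \<le> Suc n" by simp
    have "C 0 i = 0" by (rule edge_independent[OF \<alpha> n i]) (rule rows(1))
    moreover have "C 1 i = 0" by (rule edge_independent[OF \<alpha> n i]) (rule rows(2))
    moreover have "C 2 i = 0" by (rule edge_independent[OF \<alpha> n i]) (rule rows(3))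
    moreover have "s = 0 \<or> s = 1 \<or> s = 2" using \<open>s < 3\<close> by auto
    ultimately show ?thesis by auto
  qed
  have "\<forall>x\<in>T_index n. c (shift x) = 0"
  proof (rule Suc.IH)
    fix u v w assume uvw: "0 < u" "0 < v" "0 < w" "u + v + w = \<alpha>"
    have "f (u, v, w) = 0" unfolding f_def by (rule Suc.prems[OF uvw])
    moreover have "f (u, v, w) = sine_product (u, v, w) * rest (u, v, w)"
      unfolding f_rows row_def using layer0 by (simp del: mult_Suc_right sum.lessThan_Suc)
    moreover have "sine_product (u, v, w) > 0"
      unfolding sine_product_def using uvw \<alpha> by (auto intro!: mult_pos_pos sin_gt_zero)
    ultimately show "(\<Sum>x\<in>T_index n. c (shift x) * T_total n x (u, v, w)) = 0"
      by (simp add: rest_def)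
  qed
  moreover have "c x = 0" if "x \<in> {..<3} \<times> {0} \<times> {..<2 * Suc n}" for x
    using that layer0 by (auto simp: C_def)
  ultimately show ?case unfolding T_index_Suc by blast
qed

lemma T_set_eq:
  assumes "n \<ge> 1"
  shows "T_set \<alpha> n = (\<lambda>x. on_Omega \<alpha> (T_total n x)) ` T_index n"
proof -
  have R: "R_fun \<alpha> n i j = on_Omega \<alpha> (T_total n (0, j, i))" for i j
    by (auto simp: R_fun_def T_total_def R_total_def on_Omega_def fun_eq_iff)
  have G: "G_fun \<alpha> n i j = on_Omega \<alpha> (T_total n (1, j, i))" for i j
    unfolding G_fun_def R by (auto simp: T_total_def on_Omega_def Omega_def fun_eq_iff)
  have B: "B_fun \<alpha> n i j = on_Omega \<alpha> (T_total n (2, j, i))" for i j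
    unfolding B_fun_def R by (auto simp: T_total_def on_Omega_def Omega_def fun_eq_iff numeral_2_eq_2)
  let ?F = "\<lambda>x. on_Omega \<alpha> (T_total n x)"
  have "x \<in> T_index n \<longleftrightarrow>
      x \<in> (\<Union>j\<in>{0..n - 1}. \<Union>i\<in>{j..2 * n - 1 - j}. {(0, j, i), (1, j, i), (2, j, i)}) \<union> {(0, n, n)}"
    for x
  proof -
    obtain s j i where x: "x = (s, j, i)" by (cases x)
    have "s < 3 \<longleftrightarrow> s = 0 \<or> s = 1 \<or> s = 2" by auto
    moreover have "j \<in> {0..n - 1} \<longleftrightarrow> j < n" using assms by auto
    moreover have "i \<in> {j..2 * n - 1 - j} \<longleftrightarrow> j \<le> i \<and> i + j < 2 * n" using assms by auto
    moreover have "(s, j, i) \<in> (\<Union>j\<in>A. \<Union>i\<in>I j. {(0, j, i), (1, j, i), (2, j, i)})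
        \<longleftrightarrow> (s = 0 \<or> s = 1 \<or> s = 2) \<and> j \<in> A \<and> i \<in> I j" for A I
      by auto
    moreover have "(s, j, i) \<in> T_index n
        \<longleftrightarrow> (s < 3 \<and> j < n \<and> j \<le> i \<and> i + j < 2 * n) \<or> (s, j, i) \<in> {(0, n, n)}"
      by (auto simp: T_index_def)
    ultimately show ?thesis unfolding x Un_iff by (simp only: conj_assoc)
  qed
  then have "T_index n = (\<Union>j\<in>{0..n - 1}. \<Union>i\<in>{j..2 * n - 1 - j}. {(0, j, i), (1, j, i), (2, j, i)})
      \<union> {(0, n, n)}"
    by (rule set_eqI)
  then show ?thesis
    unfolding T_set_def R G B by (simp only: image_Un image_UN image_insert image_empty)
qed

lemma dim_T_space:
  assumes \<alpha>: "0 < \<alpha>" "\<alpha> < pi" and "n \<ge> 1"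
  shows "dim (T_space \<alpha> n) = delta n"
  unfolding T_space_def T_set_eq[OF \<open>n \<ge> 1\<close>] card_T_index[symmetric]
proof (rule dim_span_independent_family[OF finite_T_index])
  fix c assume zero: "(\<Sum>x\<in>T_index n. c x *\<^sub>R on_Omega \<alpha> (T_total n x)) = 0"
  show "\<forall>x\<in>T_index n. c x = 0"
  proof (rule T_total_independent[OF \<alpha>])
    fix u v w assume "0 < u" "0 < v" "0 < w" "u + v + w = \<alpha>"
    then have "(u, v, w) \<in> Omega \<alpha>" by (auto simp: Omega_def)
    then show "(\<Sum>x\<in>T_index n. c x * T_total n x (u, v, w)) = 0"
      using fun_cong[OF zero, of "(u, v, w)"]
      by (simp add: sum_scaleR_fun_apply on_Omega_def)
  qed
qed

section \<open>The dimension formulas\<close>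

theorem corollary4p1:
  fixes \<alpha> :: real
  assumes "0 < \<alpha>" and "\<alpha> < pi"
  shows "dim (V_space \<alpha> 0) = 1 \<and>
    (\<forall>n\<ge>1. dim (V_space \<alpha> n) = dim (V_space \<alpha> (n - 1)) + 6 * n) \<and>
    (\<forall>n. dim (V_space \<alpha> n) = 1 + 6 * (\<Sum>i=1..n. i)
       \<and> 1 + 6 * (\<Sum>i=1..n. i) = 3 * n * (n + 1) + 1
       \<and> 3 * n * (n + 1) + 1 = delta n) \<and>
    (\<forall>n\<ge>1. dim (V_space \<alpha> n) = dim (T_space \<alpha> n))"
proof -
  have V: "dim (V_space \<alpha> n) = delta n" for n
    using assms by (simp add: dim_V_space)
  have T: "dim (T_space \<alpha> n) = delta n" if "n \<ge> 1" for n
    using assms that by (simp add: dim_T_space)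
  have step: "delta n = delta (n - 1) + 6 * n" if "n \<ge> 1" for n
    using that by (cases n) (auto simp: delta_def algebra_simps)
  have sum: "1 + 6 * (\<Sum>i=1..n. i) = delta n" for n :: nat
  proof (induction n)
    case (Suc n)
    then show ?case using step[of "Suc n"] by simp
  qed (simp add: delta_def)
  have "delta 0 = 1" and closed: "3 * n * (n + 1) + 1 = delta n" for n
    by (simp_all add: delta_def)
  then show ?thesis
    unfolding V sum closed using T step by metis
qed

end
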